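(* Let $f:\mathcal X\to\mathbb R$ be any model, $\mathcal G$ any finite collection of groups $g:\mathcal X\to\{0,1\}$, and $q\in[0,1]$. For $\lambda\in\mathbb R^{\mathcal G}$ put $\hat f(x;\lambda)=f(x)+\sum_{g\in\mathcal G}\lambda_g\, g(x)$. Let $\lambda^*\in\mathbb R^{\mathcal G}$ be any solution of the optimization problem $$\min_{\lambda\in\mathbb R^{\mathcal G}}\ \mathbb E_{(x,y)\sim\mathcal D}\big[L_q(\hat f(x;\lambda),s(x,y))\big]$$ (this $\hat f(\cdot;\lambda^* )$ is the output of the algorithm BatchGCP). Then for every $g\in\mathcal G$, $$\Pr_{(x,y)\sim\mathcal D}\big[y\in\mathcal T^{\hat f}(x)\,\big|\,g(x)=1\big]=q,\qquad\text{where }\mathcal T^{\hat f}(x)=\{y\in\mathcal Y: s(x,y)\le\hat f(x;\lambda^* )\};$$ equivalently $\Pr_{(x,s)\sim\mathcal S}[s\le\hat f(x;\lambda^* )\mid g(x)=1]=q$ for every $g\in\mathcal G$. Furthermore, $PB^{\mathcal S}_q(\hat f(\cdot;\lambda^* ))\le PB^{\mathcal S}_q(f)$.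
   Context: Setting. $\mathcal D$ is a probability distribution on $\mathcal X\times\mathcal Y$, and $s:\mathcal X\times\mathcal Y\to[0,1]$ is a nonconformity score. $\mathcal S$ denotes the induced joint distribution of the pair $(x,s(x,y))$ on $\mathcal X\times[0,1]$, and $\mathcal S(x)$ the conditional distribution of the score given the feature vector $x$. Standing assumption: every $\mathcal S(x)$ is continuous (has a continuous CDF). A group is a function $g:\mathcal X\to\{0,1\}$. All functions are measurable, models are integrable under the marginal of $\mathcal D$ on $\mathcal X$, and whenever one conditions on an event it is assumed to have positive probability. Pinball loss: for $q\in[0,1]$, threshold $\tau\in\mathbb R$ and score $s$, $$L_q(\tau,s)=(s-\tau)\,q\cdot\mathbf 1[s>\tau]+(\tau-s)(1-q)\cdot\mathbf 1[s\le\tau],$$ and for a model $f$, $PB^{\mathcal S}_q(f)=\mathbb E_{(x,s)\sim\mathcal S}[L_q(f(x),s)]$. *)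

theory Defs
  imports "HOL-Probability.Probability"
begin

definition pinball_loss :: "real \<Rightarrow> real \<Rightarrow> real \<Rightarrow> real" where
  "pinball_loss q \<tau> s =
     (s - \<tau>) * q * of_bool (s > \<tau>) + (\<tau> - s) * (1 - q) * of_bool (s \<le> \<tau>)"

text \<open>
  The induced distribution is a Borel measure on the whole real line in its second component; it is
  concentrated on the unit interval when the score takes its values there.
\<close>

definition score_distribution ::
  "'x measure \<Rightarrow> ('x \<times> 'y) measure \<Rightarrow> ('x \<times> 'y \<Rightarrow> real) \<Rightarrow> ('x \<times> real) measure" where
  "score_distribution MX D s = distr D (MX \<Otimes>\<^sub>M borel) (\<lambda>(x, y). (x, s (x, y)))"

text \<open>
  \<open>K\<close> is a regular conditional distribution of the second component given the first:
  a probability kernel that disintegrates \<open>S\<close> along its first marginal.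
\<close>

definition is_conditional_distribution ::
  "'x measure \<Rightarrow> ('x \<times> real) measure \<Rightarrow> ('x \<Rightarrow> real measure) \<Rightarrow> bool" where
  "is_conditional_distribution MX S K \<longleftrightarrow>
     K \<in> MX \<rightarrow>\<^sub>M prob_algebra borel \<and>
     (\<forall>A\<in>sets MX. \<forall>B\<in>sets borel.
        emeasure S (A \<times> B) = (\<integral>\<^sup>+x\<in>A. emeasure (K x) B \<partial>distr S MX fst))"

definition is_group :: "'x measure \<Rightarrow> ('x \<Rightarrow> real) \<Rightarrow> bool" where
  "is_group MX g \<longleftrightarrow> g \<in> borel_measurable MX \<and> g \<in> space MX \<rightarrow> {0, 1}"

definition PB :: "real \<Rightarrow> ('x \<times> real) measure \<Rightarrow> ('x \<Rightarrow> real) \<Rightarrow> real" where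
  "PB q S f = (\<integral>(x, s). pinball_loss q (f x) s \<partial>S)"

text \<open>
  Coefficient vectors indexed by \<open>G\<close> are total functions on groups; only their values on \<open>G\<close> matter.
\<close>

definition shifted_model ::
  "('x \<Rightarrow> real) \<Rightarrow> ('x \<Rightarrow> real) set \<Rightarrow> (('x \<Rightarrow> real) \<Rightarrow> real) \<Rightarrow> 'x \<Rightarrow> real" where
  "shifted_model f G c x = f x + (\<Sum>g\<in>G. c g * g x)"

definition batchgcp_solution ::
  "('x \<times> 'y) measure \<Rightarrow> ('x \<times> 'y \<Rightarrow> real) \<Rightarrow> real \<Rightarrow> ('x \<Rightarrow> real) \<Rightarrow> ('x \<Rightarrow> real) set \<Rightarrow>
   (('x \<Rightarrow> real) \<Rightarrow> real) \<Rightarrow> bool" where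
  "batchgcp_solution D s q f G =
     is_arg_min (\<lambda>c. \<integral>(x, y). pinball_loss q (shifted_model f G c x) (s (x, y)) \<partial>D) (\<lambda>_. True)"

definition prediction_set ::
  "'y measure \<Rightarrow> ('x \<times> 'y \<Rightarrow> real) \<Rightarrow> ('x \<Rightarrow> real) \<Rightarrow> 'x \<Rightarrow> 'y set" where
  "prediction_set MY s h x = {y \<in> space MY. s (x, y) \<le> h x}"

end

theory Submission
  imports Defs
begin

text \<open>
  Moving the coefficient of a group \<open>g\<close> replaces the model \<open>h\<close> by \<open>h + t g\<close>.  As a
  subgradient of the pinball loss at the threshold \<open>\<tau>\<close> is \<open>1[s \<le> \<tau>] - q\<close>, convexity and
  minimality at \<open>t = 0\<close> give \<open>0 \<le> t E[g (1[s \<le> h + t g] - q)]\<close> for every \<open>t\<close>.  The expectation is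
  therefore nonnegative for \<open>t > 0\<close> and nonpositive for \<open>t < 0\<close>.  Both one-sided limits at \<open>0\<close>
  equal \<open>E[g (1[s \<le> h] - q)]\<close>, because continuity of the conditional score distributions rules
  out ties \<open>s = h\<close>, so this quantity vanishes.
\<close>

section \<open>Convexity and integrability of the pinball loss\<close>

text \<open>As a function of the threshold the loss is the maximum of two affine pieces with slopes
  \<open>- q\<close> and \<open>1 - q\<close>; the left side is the piece active at
  \<open>\<tau>'\<close>, extended to \<open>\<tau>\<close>. At the kink the slope
  \<open>1 - q\<close> is chosen, so that the coverage event with \<open>\<le>\<close>
  appears.\<close>

lemma pinball_loss_subgradient:
  "pinball_loss q \<tau>' t + (of_bool (t \<le> \<tau>') - q) * (\<tau> - \<tau>') \<le> pinball_loss q \<tau> t"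
  if "0 \<le> q" "q \<le> 1"
proof (cases "t \<le> \<tau>"; cases "t \<le> \<tau>'")
  assume "t \<le> \<tau>" "\<not> t \<le> \<tau>'"
  then show ?thesis by (simp add: pinball_loss_def algebra_simps)
next
  assume "\<not> t \<le> \<tau>" "t \<le> \<tau>'"
  then show ?thesis by (simp add: pinball_loss_def algebra_simps)
qed (auto simp: pinball_loss_def algebra_simps)

lemma pinball_loss_measurable [measurable (raw)]:
  assumes [measurable]: "f \<in> borel_measurable M" "g \<in> borel_measurable M"
  shows "(\<lambda>x. pinball_loss q (f x) (g x)) \<in> borel_measurable M"
  unfolding pinball_loss_def by measurable

text \<open>Both slopes have absolute value at most 1. The resulting majorant reduces integrability
  of the loss to that of the threshold and the score.\<close>

lemma abs_pinball_loss_le: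
  assumes "0 \<le> q" "q \<le> 1"
  shows "\<bar>pinball_loss q \<tau> t\<bar> \<le> \<bar>\<tau>\<bar> + \<bar>t\<bar>"
proof -
  have "\<bar>pinball_loss q \<tau> t\<bar> \<le> \<bar>t - \<tau>\<bar>"
    using assms by (auto simp: pinball_loss_def abs_mult intro: mult_left_le)
  then show ?thesis by linarith
qed

lemma integrable_pinball_loss:
  assumes "0 \<le> q" "q \<le> 1" "integrable M f" "integrable M g"
  shows "integrable M (\<lambda>x. pinball_loss q (f x) (g x))"
proof (rule Bochner_Integration.integrable_bound)
  show "integrable M (\<lambda>x. \<bar>f x\<bar> + \<bar>g x\<bar>)" using assms by simp
  show "(\<lambda>x. pinball_loss q (f x) (g x)) \<in> borel_measurable M"
    using assms(3,4) by measurable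
  show "AE x in M. norm (pinball_loss q (f x) (g x)) \<le> norm (\<bar>f x\<bar> + \<bar>g x\<bar>)"
    using abs_pinball_loss_le[OF assms(1,2)] by (auto intro!: AE_I2)
qed

section \<open>First-order condition for a minimizer of the expected pinball loss\<close>

context prob_space
begin

text \<open>The subgradient is taken at the moved threshold \<open>h + t * g\<close>, not at
  \<open>h\<close>: this bounds the increase of the loss from above, and minimality makes the
  expected increase nonnegative. The factor \<open>t\<close> stays, since its sign decides the
  direction after division.\<close>

lemma pinball_minimizer_slope:
  fixes h g s :: "'a \<Rightarrow> real"
  assumes q: "0 \<le> q" "q \<le> 1"
    and h: "integrable M h" and s: "integrable M s"
    and g [measurable]: "g \<in> borel_measurable M" and g01: "g \<in> space M \<rightarrow> {0, 1}"
    and min: "expectation (\<lambda>x. pinball_loss q (h x) (s x))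
                \<le> expectation (\<lambda>x. pinball_loss q (h x + t * g x) (s x))"
  shows "0 \<le> t * (expectation (\<lambda>x. g x * of_bool (s x \<le> h x + t * g x)) - q * expectation g)"
proof -
  have [measurable]: "h \<in> borel_measurable M" "s \<in> borel_measurable M" using h s by auto
  have bnd: "\<bar>g x\<bar> \<le> 1" if "x \<in> space M" for x using g01 that by (fastforce simp: Pi_iff)
  have gi: "integrable M g"
    by (rule integrable_const_bound[where B=1]) (auto intro!: AE_I2 bnd)
  have gbi: "integrable M (\<lambda>x. g x * of_bool (s x \<le> h x + t * g x))"
    by (rule integrable_const_bound[where B=1]) (auto intro!: AE_I2 bnd simp: of_bool_def)
  have L0: "integrable M (\<lambda>x. pinball_loss q (h x) (s x))"
    by (rule integrable_pinball_loss[OF q h s])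
  have Lt: "integrable M (\<lambda>x. pinball_loss q (h x + t * g x) (s x))"
    by (rule integrable_pinball_loss[OF q _ s]) (use h gi in simp)
  have "0 \<le> expectation (\<lambda>x. pinball_loss q (h x + t * g x) (s x) - pinball_loss q (h x) (s x))"
    using min L0 Lt by simp
  also have "\<dots> \<le> expectation (\<lambda>x. t * (g x * of_bool (s x \<le> h x + t * g x) - q * g x))"
  proof (rule integral_mono)
    fix x
    show "pinball_loss q (h x + t * g x) (s x) - pinball_loss q (h x) (s x)
        \<le> t * (g x * of_bool (s x \<le> h x + t * g x) - q * g x)"
      using pinball_loss_subgradient[OF q, of "h x + t * g x" "s x" "h x"]
      by (simp add: algebra_simps)
  qed (use L0 Lt gi gbi in auto)
  also have "\<dots> = t * (expectation (\<lambda>x. g x * of_bool (s x \<le> h x + t * g x)) - q * expectation g)"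
    using gi gbi by simp
  finally show ?thesis .
qed

text \<open>Letting \<open>t\<close> tend to 0 from either side squeezes the coverage on the group.
  The product form avoids conditioning, so no positive probability is required here.\<close>

lemma pinball_minimizer_coverage:
  fixes h g s :: "'a \<Rightarrow> real"
  assumes q: "0 \<le> q" "q \<le> 1"
    and h: "integrable M h" and s: "integrable M s"
    and g [measurable]: "g \<in> borel_measurable M" and g01: "g \<in> space M \<rightarrow> {0, 1}"
    and min: "\<And>t. expectation (\<lambda>x. pinball_loss q (h x) (s x))
                \<le> expectation (\<lambda>x. pinball_loss q (h x + t * g x) (s x))"
    and no_ties: "AE x in M. s x \<noteq> h x"
  shows "prob {x \<in> space M. s x \<le> h x \<and> g x = 1} = q * prob {x \<in> space M. g x = 1}"
proof -
  have [measurable]: "h \<in> borel_measurable M" "s \<in> borel_measurable M" using h s by auto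
  have bnd: "\<bar>g x\<bar> \<le> 1" if "x \<in> space M" for x using g01 that by (fastforce simp: Pi_iff)
  define I where "I t = expectation (\<lambda>x. g x * of_bool (s x \<le> h x + t * g x))" for t
  \<comment> \<open>Stated for every null sequence, so that it serves the limits from the right and
    from the left.\<close>
  have lim: "(\<lambda>n. I (u n)) \<longlonglongrightarrow> I 0" if u: "u \<longlonglongrightarrow> 0" for u
    unfolding I_def
  proof (rule integral_dominated_convergence[where w="\<lambda>_. 1"])
    show "AE x in M. (\<lambda>n. g x * of_bool (s x \<le> h x + u n * g x))
            \<longlonglongrightarrow> g x * of_bool (s x \<le> h x + 0 * g x)"
      using no_ties
    proof eventually_elim
      case (elim x)
      have conv: "(\<lambda>n. h x + u n * g x) \<longlonglongrightarrow> h x"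
        using tendsto_add[OF tendsto_const tendsto_mult_right[OF u, of "g x"], of "h x"] by simp
      \<comment> \<open>Off ties, \<open>s x\<close> lies strictly on one side of
        \<open>h x\<close>, and the moved thresholds end up on the same side; the indicator is
        eventually constant.\<close>
      have "\<forall>\<^sub>F n in sequentially. (s x \<le> h x + u n * g x) = (s x \<le> h x)"
      proof (cases "s x < h x")
        case True
        from order_tendstoD(1)[OF conv True] True show ?thesis by (auto elim: eventually_mono)
      next
        case False
        with elim have "h x < s x" by simp
        from order_tendstoD(2)[OF conv this] this show ?thesis by (auto elim: eventually_mono)
      qed
      then show ?case
        by (intro tendsto_eventually) (auto elim: eventually_mono)
    qed
    show "AE x in M. norm (g x * of_bool (s x \<le> h x + u n * g x)) \<le> 1" for n
      by (auto intro!: AE_I2 bnd simp: of_bool_def)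
  qed auto
  have sgn: "0 \<le> t * (I t - q * expectation g)" for t
    unfolding I_def by (rule pinball_minimizer_slope[OF q h s g g01 min])
  \<comment> \<open>Steps \<open>1 / Suc n\<close> are positive already at \<open>n = 0\<close>, so
    \<open>t\<close> can be cancelled from \<open>sgn\<close>; the negated steps below give the
    reverse inequality.\<close>
  have "q * expectation g \<le> I 0"
  proof (rule LIMSEQ_le_const[OF lim])
    show "(\<lambda>n. 1 / real (Suc n)) \<longlonglongrightarrow> 0" by (rule LIMSEQ_Suc[OF lim_1_over_n])
    show "\<exists>N. \<forall>n\<ge>N. q * expectation g \<le> I (1 / real (Suc n))"
      using sgn[of "1 / real (Suc _)"] by (auto simp: zero_le_divide_iff)
  qed
  moreover have "I 0 \<le> q * expectation g"
  proof (rule LIMSEQ_le_const2[OF lim])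
    show "(\<lambda>n. - (1 / real (Suc n))) \<longlonglongrightarrow> 0"
      using tendsto_minus[OF LIMSEQ_Suc[OF lim_1_over_n]] by simp
    show "\<exists>N. \<forall>n\<ge>N. I (- (1 / real (Suc n))) \<le> q * expectation g"
      using sgn[of "- (1 / real (Suc _))"] by (auto simp: zero_le_mult_iff divide_le_0_iff)
  qed
  moreover have "I 0 = expectation (indicator {x \<in> space M. s x \<le> h x \<and> g x = 1})"
    unfolding I_def by (rule Bochner_Integration.integral_cong) (use g01 in \<open>auto simp: indicator_def\<close>)
  moreover have "expectation g = expectation (indicator {x \<in> space M. g x = 1})"
    by (rule Bochner_Integration.integral_cong) (use g01 in \<open>auto simp: indicator_def\<close>)
  ultimately show ?thesis by simp
qed

end

section \<open>Disintegration of the score distribution and absence of ties\<close>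

text \<open>Both measures agree on measurable rectangles, an intersection-stable generator. The
  kernel places \<open>K x\<close> on the fibre over \<open>x\<close>; the bind form computes the
  measure of every measurable set, such as a graph, from its fibres.\<close>

lemma conditional_distribution_eq_bind:
  assumes S: "prob_space S" "sets S = sets (MX \<Otimes>\<^sub>M borel)"
    and K: "is_conditional_distribution MX S K"
  shows "S = distr S MX fst \<bind> (\<lambda>x. distr (K x) (MX \<Otimes>\<^sub>M borel) (Pair x))"
proof -
  let ?mu = "distr S MX fst" and ?P = "MX \<Otimes>\<^sub>M (borel :: real measure)"
  let ?k = "\<lambda>x. distr (K x) ?P (Pair x)"
  interpret S: prob_space S by fact
  have fst [measurable]: "fst \<in> S \<rightarrow>\<^sub>M MX"
    using S(2) by (simp cong: measurable_cong_sets)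
  have Km [measurable]: "K \<in> MX \<rightarrow>\<^sub>M prob_algebra borel"
    using K by (simp add: is_conditional_distribution_def)
  have km: "?k \<in> MX \<rightarrow>\<^sub>M prob_algebra ?P"
    by (rule measurable_distr_prob_space2[OF Km]) simp
  have mu: "?mu \<in> space (prob_algebra MX)"
    by (simp add: space_prob_algebra S.prob_space_distr)
  show ?thesis
  \<comment> \<open>The whole space is itself a rectangle of finite measure, so a constant sequence
    suffices as cover.\<close>
  proof (rule measure_eqI_generator_eq[where E="{a \<times> b | a b. a \<in> sets MX \<and> b \<in> sets borel}"
        and A="\<lambda>_. space MX \<times> UNIV" and \<Omega>="space MX \<times> UNIV"])
    show "Int_stable {a \<times> b | a b. a \<in> sets MX \<and> b \<in> sets (borel :: real measure)}"
      by (rule Int_stable_pair_measure_generator)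
    show "{a \<times> b | a b. a \<in> sets MX \<and> b \<in> sets (borel :: real measure)} \<subseteq> Pow (space MX \<times> UNIV)"
      using sets.sets_into_space by fastforce
    show "sets S = sigma_sets (space MX \<times> UNIV) {a \<times> b | a b. a \<in> sets MX \<and> b \<in> sets borel}"
      using S(2) by (simp add: sets_pair_measure)
    have "sets (?mu \<bind> ?k) = sets ?P"
      by (rule sets_bind'[OF mu km])
    then show "sets (?mu \<bind> ?k)
        = sigma_sets (space MX \<times> UNIV) {a \<times> b | a b. a \<in> sets MX \<and> b \<in> sets borel}"
      by (simp add: sets_pair_measure)
    show "range (\<lambda>_. space MX \<times> UNIV) \<subseteq> {a \<times> b | a b. a \<in> sets MX \<and> b \<in> sets (borel :: real measure)}"
      using sets.top[of MX] sets.top[of borel] by (simp only: space_borel) blast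
    fix X assume "X \<in> {a \<times> b | a b. a \<in> sets MX \<and> b \<in> sets (borel :: real measure)}"
    then obtain a b where X: "X = a \<times> b" and [measurable]: "a \<in> sets MX" "b \<in> sets borel" by auto
    have "emeasure (?mu \<bind> ?k) X = (\<integral>\<^sup>+x. emeasure (?k x) X \<partial>?mu)"
      by (rule emeasure_bind_prob_algebra[OF mu km]) (simp add: X)
    also have "\<dots> = (\<integral>\<^sup>+x\<in>a. emeasure (K x) b \<partial>?mu)"
    proof (rule nn_integral_cong)
      fix x assume "x \<in> space ?mu"
      then have x: "x \<in> space MX" by simp
      have sK: "sets (K x) = sets borel"
        using measurable_space[OF Km x] by (simp add: space_prob_algebra)
      then have "space (K x) = UNIV" by (simp add: sets_eq_imp_space_eq)
      moreover have "Pair x \<in> K x \<rightarrow>\<^sub>M ?P" using x sK by (simp cong: measurable_cong_sets)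
      ultimately have "emeasure (?k x) X = emeasure (K x) (Pair x -` X)"
        by (simp add: emeasure_distr X)
      also have "Pair x -` X = (if x \<in> a then b else {})" by (auto simp: X)
      finally show "emeasure (?k x) X = emeasure (K x) b * indicator a x"
        by (simp split: split_indicator)
    qed
    also have "\<dots> = emeasure S X"
      using K by (simp add: is_conditional_distribution_def X)
    finally show "emeasure S X = emeasure (?mu \<bind> ?k) X" by simp
  qed auto
qed

text \<open>The ties form the graph of \<open>h\<close>, which meets the fibre over \<open>x\<close>
  only in \<open>h x\<close>. A continuous cdf has no atoms, so every fibre contributes
  zero.\<close>

lemma AE_conditional_distribution_neq:
  assumes S: "prob_space S" "sets S = sets (MX \<Otimes>\<^sub>M borel)"
    and K: "is_conditional_distribution MX S K"
    and cont: "\<And>x. x \<in> space MX \<Longrightarrow> continuous_on UNIV (cdf (K x))"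
    and h [measurable]: "h \<in> borel_measurable MX"
  shows "AE (x, t) in S. t \<noteq> h x"
proof -
  let ?mu = "distr S MX fst" and ?P = "MX \<Otimes>\<^sub>M (borel :: real measure)"
  let ?k = "\<lambda>x. distr (K x) ?P (Pair x)"
  let ?N = "{p \<in> space ?P. snd p = h (fst p)}"
  interpret S: prob_space S by fact
  have fst [measurable]: "fst \<in> S \<rightarrow>\<^sub>M MX"
    using S(2) by (simp cong: measurable_cong_sets)
  have Km [measurable]: "K \<in> MX \<rightarrow>\<^sub>M prob_algebra borel"
    using K by (simp add: is_conditional_distribution_def)
  have km: "?k \<in> MX \<rightarrow>\<^sub>M prob_algebra ?P"
    by (rule measurable_distr_prob_space2[OF Km]) simp
  have mu: "?mu \<in> space (prob_algebra MX)"
    by (simp add: space_prob_algebra S.prob_space_distr)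
  have N [measurable]: "?N \<in> sets ?P" by measurable
  have "emeasure S ?N = (\<integral>\<^sup>+x. emeasure (?k x) ?N \<partial>?mu)"
    by (subst conditional_distribution_eq_bind[OF S K])
      (rule emeasure_bind_prob_algebra[OF mu km N])
  also have "\<dots> = (\<integral>\<^sup>+x. 0 \<partial>?mu)"
  proof (rule nn_integral_cong)
    fix x assume "x \<in> space ?mu"
    then have x: "x \<in> space MX" by simp
    have sK: "sets (K x) = sets borel" and "prob_space (K x)"
      using measurable_space[OF Km x] by (auto simp: space_prob_algebra)
    then interpret Kx: prob_space "K x" by simp
    have spK: "space (K x) = UNIV" using sK by (simp add: sets_eq_imp_space_eq)
    interpret Kb: finite_borel_measure "K x"
      by standard (use sK in auto)
    have "isCont (cdf (K x)) (h x)"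
      using cont[OF x] by (simp add: continuous_on_eq_continuous_within)
    then have "emeasure (K x) {h x} = 0"
      by (simp add: Kb.isCont_cdf Kx.emeasure_eq_measure)
    moreover have "Pair x \<in> K x \<rightarrow>\<^sub>M ?P" using x sK by (simp cong: measurable_cong_sets)
    then have "emeasure (?k x) ?N = emeasure (K x) (Pair x -` ?N \<inter> space (K x))"
      using N by (rule emeasure_distr)
    moreover have "Pair x -` ?N \<inter> space (K x) = {h x}"
      using x by (auto simp: space_pair_measure spK)
    ultimately show "emeasure (?k x) ?N = 0" by simp
  qed
  finally have "emeasure S ?N = 0" by simp
  then have "?N \<in> null_sets S" using N unfolding S(2)[symmetric] by (rule null_setsI)
  then show ?thesis
    by (rule AE_I') (use sets_eq_imp_space_eq[OF S(2)] in \<open>auto simp: space_pair_measure\<close>)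
qed

section \<open>Coverage and loss of the BatchGCP solution\<close>

theorem theorem3p1:
  fixes MX :: "'x measure" and MY :: "'y measure"
    and D :: "('x \<times> 'y) measure"
    and s :: "'x \<times> 'y \<Rightarrow> real"
    and S :: "('x \<times> real) measure"
    and K :: "'x \<Rightarrow> real measure"
    and f :: "'x \<Rightarrow> real"
    and G :: "('x \<Rightarrow> real) set"
    and q :: real
    and c :: "('x \<Rightarrow> real) \<Rightarrow> real"
  assumes "prob_space D"
    and "sets D = sets (MX \<Otimes>\<^sub>M MY)"
    and "s \<in> borel_measurable (MX \<Otimes>\<^sub>M MY)"
    and "s \<in> space (MX \<Otimes>\<^sub>M MY) \<rightarrow> {0..1}"
    and "S = score_distribution MX D s"
    and "is_conditional_distribution MX S K"
    and "\<forall>x\<in>space MX. continuous_on UNIV (cdf (K x))"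
    and "integrable (distr D MX fst) f"
    and "finite G"
    and "\<forall>g\<in>G. is_group MX g"
    and "q \<in> {0..1}"
    and "batchgcp_solution D s q f G c"
  shows "(\<forall>g\<in>G. \<P>((x, y) in D. g x = 1) > 0 \<longrightarrow>
            \<P>((x, y) in D. y \<in> prediction_set MY s (shifted_model f G c) x \<bar> g x = 1) = q \<and>
            \<P>((x, t) in S. t \<le> shifted_model f G c x \<bar> g x = 1) = q) \<and>
         PB q S (shifted_model f G c) \<le> PB q S f"
proof -
  interpret prob_space D by fact
  have q: "0 \<le> q" "q \<le> 1" using assms(11) by auto
  note sD = assms(2)
  have spD: "space D = space MX \<times> space MY"
    using sets_eq_imp_space_eq[OF sD] by (simp add: space_pair_measure)
  have sm [measurable]: "s \<in> borel_measurable D"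
    using assms(3) sD by (simp cong: measurable_cong_sets)
  have fstm [measurable]: "fst \<in> D \<rightarrow>\<^sub>M MX"
    using sD by (simp cong: measurable_cong_sets)
  let ?T = "\<lambda>p. (fst p, s p)"
  have T [measurable]: "?T \<in> D \<rightarrow>\<^sub>M MX \<Otimes>\<^sub>M borel" by measurable
  have S: "S = distr D (MX \<Otimes>\<^sub>M borel) ?T"
    using assms(5) by (simp add: score_distribution_def case_prod_unfold)
  have S_prob: "prob_space S" unfolding S by (rule prob_space_distr[OF T])
  have S_sets: "sets S = sets (MX \<Otimes>\<^sub>M borel)" by (simp add: S)
  have fi: "integrable D (\<lambda>p. f (fst p))"
    using assms(8) by (rule integrable_distr[OF fstm])
  have [measurable]: "f \<in> borel_measurable MX"
    using borel_measurable_integrable[OF assms(8)] by simp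
  have gm [measurable]: "g \<in> borel_measurable MX" and g01: "g \<in> space MX \<rightarrow> {0, 1}"
    if "g \<in> G" for g using assms(10) that by (auto simp: is_group_def)
  have gb: "\<bar>g x\<bar> \<le> 1" if "g \<in> G" "x \<in> space MX" for g x
    using g01[OF that(1)] that(2) by (fastforce simp: Pi_iff)
  have gi: "integrable D (\<lambda>p. g (fst p))" if g: "g \<in> G" for g
    by (rule integrable_const_bound[where B=1])
      (use gb[OF g] gm[OF g] spD in \<open>auto intro!: AE_I2\<close>)
  have si: "integrable D s"
    by (rule integrable_const_bound[where B=1])
      (use assms(4) spD in \<open>auto intro!: AE_I2 simp: space_pair_measure Pi_iff\<close>)
  let ?h = "shifted_model f G c"
  have hm [measurable]: "shifted_model f G c \<in> borel_measurable MX" for c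
    unfolding shifted_model_def using gm by measurable
  have hi: "integrable D (\<lambda>p. ?h (fst p))"
    unfolding shifted_model_def using fi gi by auto
  have min: "expectation (\<lambda>p. pinball_loss q (?h (fst p)) (s p))
      \<le> expectation (\<lambda>p. pinball_loss q (shifted_model f G c' (fst p)) (s p))" for c'
    using assms(12)
    by (auto simp: batchgcp_solution_def is_arg_min_linorder case_prod_unfold)
  \<comment> \<open>Ties are excluded under \<open>S\<close>, where the conditional distributions
    live, and the statement is then pulled back to \<open>D\<close>.\<close>
  have "AE p in S. snd p \<noteq> ?h (fst p)"
    using AE_conditional_distribution_neq[OF S_prob S_sets assms(6) _ hm] assms(7)
    by (simp add: case_prod_unfold)
  then have no_ties: "AE p in D. s p \<noteq> ?h (fst p)"
    unfolding S by (subst (asm) AE_distr_iff) auto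
  have cov: "prob {p \<in> space D. s p \<le> ?h (fst p) \<and> g (fst p) = 1}
      = q * prob {p \<in> space D. g (fst p) = 1}" if g: "g \<in> G" for g
  proof (rule pinball_minimizer_coverage[OF q hi si _ _ _ no_ties])
    show "(\<lambda>p. g (fst p)) \<in> borel_measurable D" using gm[OF g] by measurable
    show "(\<lambda>p. g (fst p)) \<in> space D \<rightarrow> {0, 1}" using g01[OF g] spD by auto
    fix t
    \<comment> \<open>Changing the single coefficient of \<open>g\<close> by \<open>t\<close>
      realizes the perturbation \<open>h + t * g\<close> within the family over which
      \<open>c\<close> is optimal.\<close>
    have "shifted_model f G (c(g := c g + t)) x = ?h x + t * g x" for x
      using assms(9) g
      by (simp add: shifted_model_def sum.remove[of G g] algebra_simps)
    then show "expectation (\<lambda>p. pinball_loss q (?h (fst p)) (s p))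
        \<le> expectation (\<lambda>p. pinball_loss q (?h (fst p) + t * g (fst p)) (s p))"
      using min[of "c(g := c g + t)"] by simp
  qed
  have PB: "PB q S f' = expectation (\<lambda>p. pinball_loss q (f' (fst p)) (s p))"
    if [measurable]: "f' \<in> borel_measurable MX" for f'
    unfolding PB_def S by (subst integral_distr[OF T]) (auto simp: case_prod_unfold)
  \<comment> \<open>The zero coefficient vector is a competitor, and it returns \<open>f\<close>
    itself.\<close>
  have "PB q S ?h \<le> PB q S f"
    using min[of "\<lambda>_. 0"] by (simp add: PB shifted_model_def)
  moreover have "\<P>((x, y) in D. y \<in> prediction_set MY s ?h x \<bar> g x = 1) = q \<and>
      \<P>((x, t) in S. t \<le> ?h x \<bar> g x = 1) = q"
    if g: "g \<in> G" and pos: "\<P>((x, y) in D. g x = 1) > 0" for g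
  proof
    note [measurable] = gm[OF g]
    have pos': "prob {p \<in> space D. g (fst p) = 1} > 0"
      using pos by (simp add: case_prod_unfold)
    have "{p \<in> space D. snd p \<in> prediction_set MY s ?h (fst p) \<and> g (fst p) = 1}
        = {p \<in> space D. s p \<le> ?h (fst p) \<and> g (fst p) = 1}"
      by (auto simp: prediction_set_def spD)
    then show "\<P>((x, y) in D. y \<in> prediction_set MY s ?h x \<bar> g x = 1) = q"
      using cov[OF g] pos' by (simp add: cond_prob_def case_prod_unfold)
    \<comment> \<open>Events under \<open>S\<close> pull back along \<open>?T\<close> to events
      under \<open>D\<close>, so the same product identity yields the second conditional
      probability.\<close>
    have "measure S {p \<in> space S. snd p \<le> ?h (fst p) \<and> g (fst p) = 1}
        = prob {p \<in> space D. s p \<le> ?h (fst p) \<and> g (fst p) = 1}"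
      unfolding S by (subst measure_distr[OF T])
        (auto intro!: arg_cong[where f=prob] simp: space_pair_measure spD)
    moreover have "measure S {p \<in> space S. g (fst p) = 1} = prob {p \<in> space D. g (fst p) = 1}"
      unfolding S by (subst measure_distr[OF T])
        (auto intro!: arg_cong[where f=prob] simp: space_pair_measure spD)
    ultimately show "\<P>((x, t) in S. t \<le> ?h x \<bar> g x = 1) = q"
      using cov[OF g] pos' by (simp add: cond_prob_def case_prod_unfold)
  qed
  ultimately show ?thesis by blast
qed

end
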